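(* The differenced floor quotient Möbius function $\Delta\mu_1$ satisfies the following. (a) If $p \ge 3$ is a prime number, then $\Delta\mu_1(p) = 0$. (b) If $n$ is odd and square-free, then $\Delta\mu_1(n) = 0$. (c) If $n$ has a prime divisor $p$ such that $p \ge \sqrt{n} + 1$, then $\Delta\mu_1(n) = 0$.
   Context: $\mathbb{N}^+ = \{1,2,3,\ldots\}$, and $n$ denotes a positive integer. For positive integers $d,n$, $d$ is a floor quotient of $n$, written $d \preccurlyeq_1 n$, if $d = \lfloor n/k \rfloor$ for some positive integer $k$; this relation is a partial order on $\mathbb{N}^+$. The floor quotient Möbius function $\mu_1 : \mathbb{N}^+ \times \mathbb{N}^+ \to \mathbb{Z}$ is the unique function with $\mu_1(n,n)=1$ for all $n$, $\mu_1(d,n)=0$ if $d \not\preccurlyeq_1 n$, and $\sum_{m:\, d \preccurlyeq_1 m \preccurlyeq_1 n} \mu_1(d,m) = 0$ for all $d \ne n$. Write $\mu_1(n) = \mu_1(1,n)$ for $n\ge 1$, with the convention $\mu_1(0) = 0$. The differenced floor quotient Möbius function is $\Delta\mu_1(n) = \mu_1(n) - \mu_1(n-1)$ for $n \ge 1$.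
   Formalization: In part (b) the case n = 1 is excluded, since with the convention μ_1(0) = 0 one has Δμ_1(1) = 1, so the claim as printed fails there. *)

theory Defs
  imports Complex_Main "HOL-Computational_Algebra.Squarefree"
begin

definition floor_quotient :: "nat \<Rightarrow> nat \<Rightarrow> bool"  (infix "\<preceq>\<^sub>1" 50) where
  "d \<preceq>\<^sub>1 n \<longleftrightarrow> d > 0 \<and> n > 0 \<and> (\<exists>k>0. d = n div k)"

lemma floor_quotient_iff_floor:
  "d \<preceq>\<^sub>1 n \<longleftrightarrow> d > 0 \<and> n > 0 \<and> (\<exists>k::nat. k > 0 \<and> int d = \<lfloor>real n / real k\<rfloor>)"
  by (simp add: floor_quotient_def floor_divide_of_nat_eq)

lemma floor_quotient_imp_le: "d \<preceq>\<^sub>1 n \<Longrightarrow> d \<le> n"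
  by (auto simp: floor_quotient_def)

lemma floor_quotient_refl: "n > 0 \<Longrightarrow> n \<preceq>\<^sub>1 n"
  unfolding floor_quotient_def by (metis div_by_1 zero_less_one)

(* The defining identity (sum over d \<preceq>\<^sub>1 m \<preceq>\<^sub>1 n of mu1 d m is 0 for d \<noteq> n), solved for the
   term m = n. That this is the unique function with the defining properties is shown in
   mu1_characterization and mu1_unique. Values at argument 0 lie outside the domain. *)
function mu1 :: "nat \<Rightarrow> nat \<Rightarrow> int" where
  "mu1 d n =
     (if d = n then 1
      else if d \<preceq>\<^sub>1 n then - (\<Sum>m \<in> {m. d \<preceq>\<^sub>1 m \<and> m \<preceq>\<^sub>1 n \<and> m \<noteq> n}. mu1 d m)
      else 0)"
  by pat_completeness auto
termination
  by (relation "measure snd") (auto dest: floor_quotient_imp_le)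

declare mu1.simps [simp del]

definition is_floor_quotient_moebius :: "(nat \<Rightarrow> nat \<Rightarrow> int) \<Rightarrow> bool" where
  "is_floor_quotient_moebius f \<longleftrightarrow>
     (\<forall>n>0. f n n = 1) \<and>
     (\<forall>d>0. \<forall>n>0. \<not> d \<preceq>\<^sub>1 n \<longrightarrow> f d n = 0) \<and>
     (\<forall>d>0. \<forall>n>0. d \<noteq> n \<longrightarrow> (\<Sum>m \<in> {m. d \<preceq>\<^sub>1 m \<and> m \<preceq>\<^sub>1 n}. f d m) = 0)"

lemma finite_floor_quotient_interval: "finite {m. d \<preceq>\<^sub>1 m \<and> m \<preceq>\<^sub>1 n}"
  by (rule finite_subset[of _ "{..n}"]) (auto dest: floor_quotient_imp_le)

lemma floor_quotient_interval_sum: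
  fixes f :: "nat \<Rightarrow> int"
  assumes "d \<preceq>\<^sub>1 n"
  shows "(\<Sum>m \<in> {m. d \<preceq>\<^sub>1 m \<and> m \<preceq>\<^sub>1 n}. f m) =
         f n + (\<Sum>m \<in> {m. d \<preceq>\<^sub>1 m \<and> m \<preceq>\<^sub>1 n \<and> m \<noteq> n}. f m)"
proof -
  have "n \<in> {m. d \<preceq>\<^sub>1 m \<and> m \<preceq>\<^sub>1 n}"
    using assms floor_quotient_refl by (auto simp: floor_quotient_def)
  moreover have "{m. d \<preceq>\<^sub>1 m \<and> m \<preceq>\<^sub>1 n} - {n} = {m. d \<preceq>\<^sub>1 m \<and> m \<preceq>\<^sub>1 n \<and> m \<noteq> n}"
    by auto
  ultimately show ?thesis
    by (metis (no_types, lifting) finite_floor_quotient_interval sum.remove)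
qed

lemma floor_quotient_trans:
  assumes "d \<preceq>\<^sub>1 m" "m \<preceq>\<^sub>1 n"
  shows "d \<preceq>\<^sub>1 n"
proof -
  obtain j k where "j > 0" "d = m div j" "k > 0" "m = n div k"
    using assms by (auto simp: floor_quotient_def)
  hence "d = n div (k * j)" "k * j > 0"
    by (auto simp: div_mult2_eq)
  moreover have "d > 0" "n > 0"
    using assms by (simp_all add: floor_quotient_def)
  ultimately show ?thesis
    unfolding floor_quotient_def by blast
qed

lemma mu1_characterization: "is_floor_quotient_moebius mu1"
  unfolding is_floor_quotient_moebius_def
proof (intro conjI allI impI)
  fix d n :: nat
  assume "d \<noteq> n"
  show "(\<Sum>m \<in> {m. d \<preceq>\<^sub>1 m \<and> m \<preceq>\<^sub>1 n}. mu1 d m) = 0"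
  proof (cases "d \<preceq>\<^sub>1 n")
    case True
    thus ?thesis
      using \<open>d \<noteq> n\<close> by (simp add: floor_quotient_interval_sum mu1.simps[of d n])
  next
    case False
    hence "{m. d \<preceq>\<^sub>1 m \<and> m \<preceq>\<^sub>1 n} = {}"
      using floor_quotient_trans by blast
    thus ?thesis by (simp only: sum.empty)
  qed
qed (auto simp: mu1.simps floor_quotient_refl)

lemma mu1_unique:
  assumes f: "is_floor_quotient_moebius f" and "d > 0" "n > 0"
  shows "f d n = mu1 d n"
  using \<open>n > 0\<close>
proof (induction n rule: less_induct)
  case (less n)
  show ?case
  proof (cases "d \<noteq> n \<and> d \<preceq>\<^sub>1 n")
    case True
    have "(\<Sum>m \<in> {m. d \<preceq>\<^sub>1 m \<and> m \<preceq>\<^sub>1 n \<and> m \<noteq> n}. f d m) =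
          (\<Sum>m \<in> {m. d \<preceq>\<^sub>1 m \<and> m \<preceq>\<^sub>1 n \<and> m \<noteq> n}. mu1 d m)"
    proof (rule sum.cong)
      fix m assume "m \<in> {m. d \<preceq>\<^sub>1 m \<and> m \<preceq>\<^sub>1 n \<and> m \<noteq> n}"
      hence "m < n" "m > 0"
        using floor_quotient_imp_le[of m n] by (auto simp: floor_quotient_def)
      thus "f d m = mu1 d m" by (rule less.IH)
    qed simp
    moreover have "(\<Sum>m \<in> {m. d \<preceq>\<^sub>1 m \<and> m \<preceq>\<^sub>1 n}. f d m) = 0"
      using f True \<open>d > 0\<close> less.prems by (simp add: is_floor_quotient_moebius_def)
    ultimately show ?thesis
      using True by (simp add: floor_quotient_interval_sum mu1.simps[of d n])
  next
    case False
    thus ?thesis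
      using f \<open>d > 0\<close> less.prems by (auto simp: is_floor_quotient_moebius_def mu1.simps[of d n])
  qed
qed

definition mu1_one :: "nat \<Rightarrow> int" where
  "mu1_one n = (if n = 0 then 0 else mu1 1 n)"

(* Meaningful for n \<ge> 1 only, because of truncated subtraction. *)
definition Delta_mu1 :: "nat \<Rightarrow> int"  ("\<Delta>\<mu>\<^sub>1") where
  "\<Delta>\<mu>\<^sub>1 n = mu1_one n - mu1_one (n - 1)"

(* The reason for excluding n = 1 from the claim about odd square-free n. *)
lemma Delta_mu1_1: "\<Delta>\<mu>\<^sub>1 1 = 1"
  by (simp add: Delta_mu1_def mu1_one_def mu1.simps)

end

theory Submission
  imports Defs "HOL-Library.Discrete_Functions"
begin

text \<open>
  The floor quotients of \<open>N\<close> split at the square root: with \<open>s = \<lfloor>\<surd>N\<rfloor>\<close>, all of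
  \<open>1, \<dots>, s\<close> are floor quotients, and those above \<open>s\<close> are the pairwise distinct values
  \<open>N div k\<close> for \<open>k \<le> t = N div (s + 1)\<close>. For \<open>N \<ge> 2\<close> the defining recursion of
  \<open>\<mu>\<^sub>1\<close> says that the values of \<open>\<mu>\<^sub>1\<close> at all of these sum to zero.

  Subtract this relation for \<open>n - 1\<close> from the one for \<open>n\<close>. The cut-offs \<open>s\<close> and \<open>t\<close> are the
  same for both numbers unless \<open>n\<close> is a square or a pronic number \<open>s (s + 1)\<close>. In that
  generic case the small floor quotients cancel, and
  \<open>n div k\<close> differs from \<open>(n - 1) div k\<close> (then by exactly one) only if \<open>k\<close> divides \<open>n\<close>.
  What remains is the relation \<open>(\<Sum>k | k dvd n \<and> k * k < n. \<Delta>\<mu>\<^sub>1 (n div k)) = 0\<close>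
  (lemma \<open>sum_Delta_mu1_small_divisors\<close>). Hence \<open>\<Delta>\<mu>\<^sub>1 n = 0\<close> as soon as \<open>\<Delta>\<mu>\<^sub>1\<close>
  vanishes at the other \<open>n div k\<close>.

  Both families of the theorem avoid squares and pronic numbers and are closed under
  passing from \<open>n\<close> to such an \<open>n div k\<close>, so strong induction applies. An odd number is never
  pronic, and a square-free number exceeding one is never a square. If \<open>p\<close> divides \<open>n\<close> and
  \<open>n \<le> (p - 1)\<^sup>2\<close>, then \<open>n\<close> is too small to be a square or a pronic number divisible by
  \<open>p\<close>, and a divisor \<open>k\<close> with \<open>k * k < n\<close> is below \<open>p\<close>, so \<open>p\<close> still divides \<open>n div k\<close>.
  Odd primes are square-free.
\<close>

section \<open>Floor quotients on both sides of the square root\<close>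

lemma floor_quotient_if_square_le:
  assumes "0 < d" "d * d \<le> N"
  shows "d \<preceq>\<^sub>1 N"
proof -
  define q where "q = N div d"
  have "d \<le> q"
    using assms by (simp add: q_def less_eq_div_iff_mult_less_eq)
  \<comment> \<open>The remainder of \<open>N\<close> modulo \<open>d\<close> is below \<open>d \<le> q\<close>, so dividing by \<open>q\<close> gives back \<open>d\<close>.\<close>
  have "N mod d < q"
    using assms \<open>d \<le> q\<close> by (meson mod_less_divisor order_less_le_trans)
  moreover have "N = d * q + N mod d"
    by (simp add: q_def)
  ultimately have "N div q = d"
    by (intro div_nat_eqI) (simp_all add: algebra_simps)
  moreover have "0 < q" using assms \<open>d \<le> q\<close> by simp
  moreover have "0 < N" using assms by (metis mult_pos_pos order_less_le_trans)
  ultimately show ?thesis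
    using assms unfolding floor_quotient_def by blast
qed

text \<open>
  The inequalities on \<open>s\<close> and \<open>t\<close> are what makes the two parts disjoint and exhaustive.
  Both \<open>s\<close> and \<open>t\<close> are parameters because the same pair has to serve two consecutive numbers.
\<close>

lemma sum_floor_quotients_split:
  fixes f :: "nat \<Rightarrow> int"
  assumes "0 < N" "s * s \<le> N" "t \<le> s" "t * (s + 1) \<le> N" "N < (t + 1) * (s + 1)"
  shows "(\<Sum>m \<in> {m. m \<preceq>\<^sub>1 N}. f m) = (\<Sum>m=1..s. f m) + (\<Sum>k=1..t. f (N div k))"
proof -
  have large: "s < N div k" if "k \<in> {1..t}" for k
  proof -
    have "(s + 1) * k \<le> N"
      using that assms(4) mult_le_mono1[of k t "s + 1"] by (simp add: mult.commute)
    thus ?thesis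
      using that by (simp add: Suc_le_eq[symmetric] less_eq_div_iff_mult_less_eq)
  qed
  have small: "N div k \<le> s" if "t < k" for k
  proof -
    have "N < k * (s + 1)"
      using that assms(5) mult_le_mono1[of "t + 1" k "s + 1"] by linarith
    hence "N div k < s + 1"
      using that by (simp add: div_less_iff_less_mult mult.commute)
    thus ?thesis by simp
  qed
  have decreasing: "N div l < N div k" if "k \<in> {1..t}" "l \<in> {1..t}" "k < l" for k l
  proof -
    \<comment> \<open>The quotient \<open>N div l\<close> exceeds \<open>s\<close>, hence also \<open>k\<close>, so increasing it by one
      costs at most what replacing the factor \<open>l\<close> by \<open>k\<close> gains.\<close>
    have "k \<le> N div l" using large[OF that(2)] that assms(3) by auto
    hence "(N div l + 1) * k \<le> (N div l) * (k + 1)" by (simp add: algebra_simps)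
    also have "\<dots> \<le> (N div l) * l" using that by (intro mult_le_mono2) simp
    also have "\<dots> \<le> N" by simp
    finally show ?thesis
      using that by (simp add: Suc_le_eq[symmetric] less_eq_div_iff_mult_less_eq)
  qed
  have inj: "inj_on (\<lambda>k. N div k) {1..t}"
    by (rule inj_onI) (metis decreasing less_irrefl linorder_neqE_nat)
  have "m \<preceq>\<^sub>1 N" if "m \<in> {1..s}" for m
  proof -
    have "m * m \<le> s * s" using that by (intro mult_le_mono) auto
    thus ?thesis using that assms(2) by (intro floor_quotient_if_square_le) auto
  qed
  moreover have "N div k \<preceq>\<^sub>1 N" if "k \<in> {1..t}" for k
  proof -
    have "0 < N div k" "0 < k" using large[OF that] that by auto
    thus ?thesis using assms(1) unfolding floor_quotient_def by blast
  qed
  moreover have "m \<in> {1..s} \<union> (\<lambda>k. N div k) ` {1..t}" if quotient: "m \<preceq>\<^sub>1 N" for m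
  proof -
    obtain k where "0 < k" "m = N div k" "0 < m"
      using quotient by (auto simp: floor_quotient_def)
    show ?thesis
    proof (cases "k \<le> t")
      case True
      hence "k \<in> {1..t}" using \<open>0 < k\<close> by simp
      thus ?thesis unfolding \<open>m = N div k\<close> by blast
    next
      case False
      hence "m \<le> s" unfolding \<open>m = N div k\<close> by (intro small) simp
      thus ?thesis using \<open>0 < m\<close> by simp
    qed
  qed
  ultimately have split: "{m. m \<preceq>\<^sub>1 N} = {1..s} \<union> (\<lambda>k. N div k) ` {1..t}"
    by blast
  have "(\<Sum>m \<in> {m. m \<preceq>\<^sub>1 N}. f m) = (\<Sum>m=1..s. f m) + sum f ((\<lambda>k. N div k) ` {1..t})"
    unfolding split
  proof (rule sum.union_disjoint)
    show "{1..s} \<inter> (\<lambda>k. N div k) ` {1..t} = {}"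
      using large by fastforce
  qed auto
  thus ?thesis
    using sum.reindex[OF inj, of f] by (simp add: comp_def)
qed

section \<open>A divisor relation for the differenced function\<close>

lemma sum_mu1_one_floor_quotients:
  assumes "2 \<le> N"
  shows "(\<Sum>m \<in> {m. m \<preceq>\<^sub>1 N}. mu1_one m) = 0"
proof -
  have one: "1 \<preceq>\<^sub>1 m" if "0 < m" for m
    using that by (intro floor_quotient_if_square_le) auto
  have "(\<Sum>m \<in> {m. m \<preceq>\<^sub>1 N}. mu1_one m) = (\<Sum>m \<in> {m. 1 \<preceq>\<^sub>1 m \<and> m \<preceq>\<^sub>1 N}. mu1 1 m)"
    using one by (intro sum.cong) (auto simp: floor_quotient_def mu1_one_def)
  also have "\<dots> = 0"
    using mu1_characterization assms unfolding is_floor_quotient_moebius_def by auto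
  finally show ?thesis .
qed

lemma mu1_one_div_diff:
  assumes "0 < n" "0 < k"
  shows "mu1_one (n div k) - mu1_one ((n - 1) div k) =
           (if k dvd n then \<Delta>\<mu>\<^sub>1 (n div k) else 0)"
proof -
  obtain m where "n = Suc m" using assms(1) gr0_conv_Suc by blast
  thus ?thesis
    by (auto simp: Delta_mu1_def div_Suc dvd_eq_mod_eq_0)
qed

text \<open>
  The difference of the Moebius relations at \<open>n\<close> and \<open>n - 1\<close>. For squares and for pronic
  numbers the cut-off changes between the two numbers, which leaves an extra value of
  \<open>\<mu>\<^sub>1\<close>; the hypotheses exclude this.
\<close>

lemma sum_Delta_mu1_small_divisors:
  assumes "3 \<le> n" and nonsquare: "\<And>s. n \<noteq> s * s" and nonpronic: "\<And>s. n \<noteq> s * (s + 1)"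
  shows "(\<Sum>k | k dvd n \<and> k * k < n. \<Delta>\<mu>\<^sub>1 (n div k)) = 0"
proof -
  define s where "s = floor_sqrt (n - 1)"
  define t where "t = (n - 1) div (s + 1)"
  have s_le: "s * s \<le> n - 1"
    using floor_sqrt_power2_le[of "n - 1"] by (simp add: s_def power2_eq_square)
  have s_less: "n - 1 < (s + 1) * (s + 1)"
    using Suc_floor_sqrt_power2_gt[of "n - 1"] by (simp add: s_def power2_eq_square)
  have t_le_s: "t \<le> s"
    using s_less by (simp add: t_def div_less_iff_less_mult less_Suc_eq_le[symmetric])
  have t_le: "t * (s + 1) \<le> n - 1"
    unfolding t_def by (rule div_times_less_eq_dividend)
  have less_t: "n - 1 < (t + 1) * (s + 1)"
    unfolding t_def using dividend_less_div_times[of "s + 1" "n - 1"]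
    by (simp add: algebra_simps)
  have s_le_t: "s \<le> t + 1"
  proof (rule ccontr)
    assume "\<not> s \<le> t + 1"
    then have "(t + 1) * (s + 1) \<le> (s - 1) * (s + 1)" by (intro mult_le_mono1) simp
    also have "\<dots> \<le> s * s" by (cases s) auto
    finally show False using s_le less_t by linarith
  qed
  \<comment> \<open>Otherwise \<open>n = (t + 1) * (s + 1)\<close> with \<open>t + 1 \<in> {s, s + 1}\<close>.\<close>
  have n_less: "n < (t + 1) * (s + 1)"
  proof -
    have "t + 1 = s \<or> t + 1 = s + 1" using s_le_t t_le_s by linarith
    hence "n \<noteq> (t + 1) * (s + 1)" using nonsquare nonpronic by metis
    thus ?thesis using less_t by linarith
  qed
  let ?f = "mu1_one"
  have "(\<Sum>m=1..s. ?f m) + (\<Sum>k=1..t. ?f (n div k)) = 0"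
    using sum_floor_quotients_split[of n s t ?f] sum_mu1_one_floor_quotients[of n]
      assms(1) s_le t_le_s t_le n_less by simp
  moreover have "(\<Sum>m=1..s. ?f m) + (\<Sum>k=1..t. ?f ((n - 1) div k)) = 0"
    using sum_floor_quotients_split[of "n - 1" s t ?f] sum_mu1_one_floor_quotients[of "n - 1"]
      assms(1) s_le t_le_s t_le less_t by simp
  ultimately have "0 = (\<Sum>k=1..t. ?f (n div k) - ?f ((n - 1) div k))"
    by (simp add: sum_subtractf)
  also have "\<dots> = (\<Sum>k=1..t. if k dvd n then \<Delta>\<mu>\<^sub>1 (n div k) else 0)"
    using assms(1) by (intro sum.cong refl mu1_one_div_diff) auto
  also have "\<dots> = (\<Sum>k \<in> {k \<in> {1..t}. k dvd n}. \<Delta>\<mu>\<^sub>1 (n div k))"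
    by (rule sum.inter_filter[symmetric]) simp
  also have "{k \<in> {1..t}. k dvd n} = {k. k dvd n \<and> k * k < n}"
  proof (intro Collect_cong iffI conjI; (elim conjE)?)
    fix k assume "k \<in> {1..t}"
    hence "k * k \<le> t * (s + 1)" using t_le_s by (intro mult_le_mono) auto
    thus "k * k < n" using t_le assms(1) by linarith
  next
    fix k assume k: "k dvd n" "k * k < n"
    obtain e where e: "n = k * e" using k(1) by blast
    have "k < e" using k(2) e by simp
    have "k \<le> t"
    proof (rule ccontr)
      \<comment> \<open>A cofactor \<open>e\<close> above \<open>s\<close> makes \<open>k * e\<close> too large, one up to \<open>s\<close> too small.\<close>
      assume "\<not> k \<le> t"
      hence "t + 1 \<le> k" by simp
      show False
      proof (cases "s + 1 \<le> e")
        case True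
        hence "(t + 1) * (s + 1) \<le> n"
          unfolding e using \<open>t + 1 \<le> k\<close> by (intro mult_le_mono) auto
        thus False using n_less by simp
      next
        case False
        hence "n \<le> s * s"
          unfolding e using \<open>k < e\<close> by (intro mult_le_mono) auto
        thus False using s_le assms(1) by linarith
      qed
    qed
    moreover have "0 < k" using e assms(1) by (cases k) auto
    ultimately show "k \<in> {1..t}" by simp
  qed auto
  finally show ?thesis by simp
qed

lemma Delta_mu1_eq_0_if_proper_quotients:
  assumes "3 \<le> n" "\<And>s. n \<noteq> s * s" "\<And>s. n \<noteq> s * (s + 1)"
    and zero: "\<And>k. k dvd n \<Longrightarrow> 1 < k \<Longrightarrow> k * k < n \<Longrightarrow> \<Delta>\<mu>\<^sub>1 (n div k) = 0"
  shows "\<Delta>\<mu>\<^sub>1 n = 0"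
proof -
  let ?K = "{k. k dvd n \<and> k * k < n}"
  have "finite ?K" using assms(1) by (intro finite_subset[OF _ finite_divisors_nat[of n]]) auto
  moreover have "1 \<in> ?K" using assms(1) by simp
  ultimately have "(\<Sum>k\<in>?K. \<Delta>\<mu>\<^sub>1 (n div k)) =
      \<Delta>\<mu>\<^sub>1 (n div 1) + (\<Sum>k\<in>?K - {1}. \<Delta>\<mu>\<^sub>1 (n div k))"
    by (rule sum.remove)
  also have "(\<Sum>k\<in>?K - {1}. \<Delta>\<mu>\<^sub>1 (n div k)) = 0"
  proof (intro sum.neutral ballI)
    fix k assume k: "k \<in> ?K - {1}"
    hence "0 < k" using assms(1) by (cases k) auto
    thus "\<Delta>\<mu>\<^sub>1 (n div k) = 0" using k by (intro zero) auto
  qed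
  finally show ?thesis
    using sum_Delta_mu1_small_divisors[OF assms(1-3)] by simp
qed

section \<open>Vanishing of the differenced function\<close>

lemma Delta_mu1_odd_squarefree:
  assumes "1 < n" "odd n" "squarefree n"
  shows "\<Delta>\<mu>\<^sub>1 n = 0"
  using assms
proof (induction n rule: less_induct)
  case (less n)
  show ?case
  proof (rule Delta_mu1_eq_0_if_proper_quotients)
    show "3 \<le> n" using less.prems by (cases "n = 2") auto
    show "n \<noteq> s * s" for s
    proof
      assume "n = s * s"
      hence "s dvd 1" using less.prems(3) by (auto simp: squarefree_def power2_eq_square)
      thus False using \<open>n = s * s\<close> less.prems(1) by simp
    qed
    show "n \<noteq> s * (s + 1)" for s using less.prems(2) by auto
    fix k assume k: "k dvd n" "1 < k" "k * k < n"
    then obtain e where e: "n = k * e" by blast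
    have "k < e" using k e by simp
    hence "e < n" "1 < e" using k e by auto
    moreover have "odd e" using less.prems(2) e by simp
    moreover have "squarefree e" using less.prems(3) e by (auto dest: squarefree_multD)
    ultimately have "\<Delta>\<mu>\<^sub>1 e = 0" by (rule less.IH)
    thus "\<Delta>\<mu>\<^sub>1 (n div k) = 0" using e k(2) by simp
  qed
qed

text \<open>
  The next multiple of \<open>p\<close> above the bound is \<open>(p - 1) * p\<close>, which is pronic. So the
  range of \<open>n\<close> ends exactly where the divisor relation stops being available.
\<close>

lemma Delta_mu1_large_prime_divisor:
  fixes p n :: nat
  assumes "0 < n" "prime p" "p dvd n" "n \<le> (p - 1) * (p - 1)"
  shows "\<Delta>\<mu>\<^sub>1 n = 0"
  using assms
proof (induction n rule: less_induct)
  case (less n)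
  have "p \<le> n" using less.prems by (intro dvd_imp_le) auto
  have "p \<noteq> 2" using \<open>p \<le> n\<close> less.prems(4) by auto
  hence "3 \<le> p" using prime_ge_2_nat[OF less.prems(2)] by simp
  show ?case
  proof (rule Delta_mu1_eq_0_if_proper_quotients)
    show "3 \<le> n" using \<open>3 \<le> p\<close> \<open>p \<le> n\<close> by simp
    show "n \<noteq> s * s" for s
    proof
      assume n: "n = s * s"
      hence "p dvd s" "0 < s" using less.prems by (auto simp: prime_dvd_mult_iff)
      hence "p \<le> s" by (intro dvd_imp_le)
      hence "p * p \<le> n" unfolding n by (intro mult_le_mono)
      moreover have "(p - 1) * (p - 1) < p * p" using \<open>3 \<le> p\<close> by (intro mult_strict_mono) auto
      ultimately show False using less.prems(4) by linarith
    qed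
    show "n \<noteq> s * (s + 1)" for s
    proof
      assume n: "n = s * (s + 1)"
      have "p dvd s \<or> p dvd s + 1"
        using less.prems(2,3) unfolding n by (simp only: prime_dvd_mult_iff)
      moreover have "0 < s" using n less.prems(1) by simp
      ultimately have "p \<le> s + 1" by (auto dest!: dvd_imp_le)
      hence "(p - 1) * p \<le> n" unfolding n by (intro mult_le_mono) auto
      moreover have "(p - 1) * (p - 1) < (p - 1) * p" using \<open>3 \<le> p\<close> by simp
      ultimately show False using less.prems(4) by linarith
    qed
    fix k assume k: "k dvd n" "1 < k" "k * k < n"
    then obtain e where e: "n = k * e" by blast
    have "0 < e" "e < n" using e k less.prems(1) by auto
    have "k < p"
    proof (rule ccontr)
      assume "\<not> k < p"
      hence "(p - 1) * (p - 1) \<le> k * k" by (intro mult_le_mono) auto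
      thus False using k(3) less.prems(4) by linarith
    qed
    hence "\<not> p dvd k" using k(2) by (auto dest: dvd_imp_le)
    hence "p dvd e" using less.prems(2,3) e by (auto simp: prime_dvd_mult_iff)
    have "\<Delta>\<mu>\<^sub>1 e = 0"
      using less.IH[of e] \<open>0 < e\<close> \<open>e < n\<close> \<open>p dvd e\<close> less.prems(2,4) by simp
    thus "\<Delta>\<mu>\<^sub>1 (n div k) = 0" using e k(2) by simp
  qed
qed

theorem proposition6p16:
  shows "(\<forall>p::nat. prime p \<and> p \<ge> 3 \<longrightarrow> \<Delta>\<mu>\<^sub>1 p = 0) \<and>
    (\<forall>n::nat. n > 1 \<and> odd n \<and> squarefree n \<longrightarrow> \<Delta>\<mu>\<^sub>1 n = 0) \<and>
    (\<forall>n::nat. n > 0 \<and> (\<exists>p::nat. prime p \<and> p dvd n \<and> real p \<ge> sqrt (real n) + 1)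
       \<longrightarrow> \<Delta>\<mu>\<^sub>1 n = 0)"
proof (intro conjI allI impI; elim conjE exE)
  fix p :: nat
  assume "prime p" "3 \<le> p"
  thus "\<Delta>\<mu>\<^sub>1 p = 0"
    by (intro Delta_mu1_odd_squarefree) (auto intro: squarefree_prime simp: prime_odd_nat)
next
  fix n :: nat
  assume "1 < n" "odd n" "squarefree n"
  thus "\<Delta>\<mu>\<^sub>1 n = 0" by (rule Delta_mu1_odd_squarefree)
next
  fix n p :: nat
  assume n: "0 < n" and p: "prime p" "p dvd n" "sqrt (real n) + 1 \<le> real p"
  have "sqrt (real n) \<le> real (p - 1)"
    using p(3) prime_gt_0_nat[OF p(1)] by (simp add: of_nat_diff)
  hence "real n \<le> real ((p - 1) * (p - 1))"
    by (metis of_nat_power power2_eq_square real_sqrt_le_iff real_sqrt_unique of_nat_0_le_iff)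
  hence "n \<le> (p - 1) * (p - 1)" by (simp only: of_nat_le_iff)
  thus "\<Delta>\<mu>\<^sub>1 n = 0" using n p(1,2) by (intro Delta_mu1_large_prime_divisor)
qed

end
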